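(* Let $P_X$ be a probability distribution on a finite alphabet $\mathcal{X}$, let $E_0>0$, and let $R_{\mathrm{s}}\ge 0$ and $R_{\mathrm{w}}\ge 0$ be a secret-key rate and a helper-message rate. Let $$E_{\mathrm{FA}}(R_{\mathrm{w}},R_{\mathrm{s}})=\min_{Q_X}\left[D(Q_X\|P_X)+\min\{R_{\mathrm{s}},[H_Q(X)-R_{\mathrm{w}}]_+\}\right]$$ be the best achievable false-accept error exponent of fixed-rate codes with rates $(R_{\mathrm{w}},R_{\mathrm{s}})$, the outer minimum being over all probability distributions $Q_X$ on $\mathcal{X}$. Then $E_{\mathrm{FA}}(R_{\mathrm{w}},R_{\mathrm{s}})\ge E_0$ if and only if both of the following hold: $$R_{\mathrm{s}}\ge E_0\qquad\text{and}\qquad R_{\mathrm{w}}\le R_{\mathrm{w}}^*(E_0),$$ where $$R_{\mathrm{w}}^*(E_0)=\min_{\{Q_X:\ D(Q_X\|P_X)\le E_0\}}\mathbf{E}_Q\ln\frac{1}{P_X(X)}-E_0.$$ Moreover, $$R_{\mathrm{w}}^*(E_0)=\sup_{\lambda\ge 0}\left\{-\lambda\ln\left(\sum_{x\in\mathcal{X}}[P_X(x)]^{1+1/\lambda}\right)-(1+\lambda)E_0\right\}.$$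
   Context: All logarithms are natural and $[t]_+=\max\{0,t\}$. $D(\cdot\|\cdot)$ is the Kullback--Leibler divergence (equal to $+\infty$ when absolute continuity fails), $H_Q(X)$ is the Shannon entropy of $Q_X$, and $\mathbf{E}_Q\ln\frac{1}{P_X(X)}=\sum_xQ_X(x)\ln\frac{1}{P_X(x)}$ (with $0\cdot\ln\frac10=0$). In the supremum, the expression at $\lambda=0$ is understood as its limit as $\lambda\downarrow 0$. Background: in a biometric authentication system, a source vector of length $n$ drawn i.i.d. from $P_X$ is mapped to a secret key in a set of size $e^{nR_{\mathrm{s}}}$ and to a helper message in a set of size $e^{nR_{\mathrm{w}}}$. The false-accept probability is the probability that an imposter who sees only the helper message guesses the secret key correctly. The best achievable exponent of this probability is known to be given by the displayed formula for $E_{\mathrm{FA}}(R_{\mathrm{w}},R_{\mathrm{s}})$, and the existence of fixed-rate codes with false-accept exponent at least $E_0$ means $E_{\mathrm{FA}}(R_{\mathrm{w}},R_{\mathrm{s}})\ge E_0$. *)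

theory Defs
  imports "HOL-Probability.Probability"
begin

text \<open>
  A finite alphabet is a type of class \<open>finite\<close>; a distribution on it is a \<open>pmf\<close>.
  Information quantities are in nats (base \<open>exp 1\<close>) and, where they can be infinite, in \<open>ereal\<close>.
\<close>

text \<open>
  \<open>kl_div Q P\<close> is $D(Q \| P)$. The library's real-valued \<open>KL_divergence\<close> takes the reference
  measure first, and is only meaningful under absolute continuity.
\<close>

definition kl_div :: "'a::finite pmf \<Rightarrow> 'a pmf \<Rightarrow> ereal" where
  "kl_div Q P =
     (if absolutely_continuous (measure_pmf P) (measure_pmf Q)
      then ereal (KL_divergence (exp 1) (measure_pmf P) (measure_pmf Q))
      else \<infinity>)"

definition shannon_entropy :: "'a::finite pmf \<Rightarrow> real" where
  "shannon_entropy Q = prob_space.entropy (measure_pmf Q) (exp 1) (count_space UNIV) (\<lambda>x. x)"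

text \<open>
  $\mathbf{E}_Q \ln (1 / P(X))$, equal to \<open>\<infinity>\<close> unless the support of \<open>Q\<close> lies in that of \<open>P\<close>.
  The convention $0 \cdot \ln (1/0) = 0$ is \<open>0 * \<infinity> = 0\<close> in \<open>ereal\<close>.
\<close>

definition expected_log_inv :: "'a::finite pmf \<Rightarrow> 'a pmf \<Rightarrow> ereal" where
  "expected_log_inv Q P =
     (\<Sum>x\<in>UNIV. ereal (pmf Q x) * (if pmf P x = 0 then \<infinity> else ereal (ln (1 / pmf P x))))"

definition fa_objective :: "'a::finite pmf \<Rightarrow> real \<Rightarrow> real \<Rightarrow> 'a pmf \<Rightarrow> ereal" where
  "fa_objective P Rw Rs Q =
     kl_div Q P + ereal (min Rs (max 0 (shannon_entropy Q - Rw)))"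

definition E_FA :: "'a::finite pmf \<Rightarrow> real \<Rightarrow> real \<Rightarrow> ereal" where
  "E_FA P Rw Rs = (INF Q. fa_objective P Rw Rs Q)"

definition Rw_star :: "'a::finite pmf \<Rightarrow> real \<Rightarrow> ereal" where
  "Rw_star P E0 = (INF Q\<in>{Q. kl_div Q P \<le> ereal E0}. expected_log_inv Q P) - ereal E0"

definition dual_expr :: "'a::finite pmf \<Rightarrow> real \<Rightarrow> real \<Rightarrow> real" where
  "dual_expr P E0 l =
     - l * ln (\<Sum>x\<in>UNIV. pmf P x powr (1 + 1 / l)) - (1 + l) * E0"

text \<open>
  At \<open>0\<close> the expression is replaced by its right-hand limit; \<open>dual_expr_tendsto\<close> below shows
  that this limit exists.
\<close>

definition dual_objective :: "'a::finite pmf \<Rightarrow> real \<Rightarrow> real \<Rightarrow> real" where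
  "dual_objective P E0 l =
     (if l = 0 then Lim (at_right 0) (dual_expr P E0) else dual_expr P E0 l)"

lemma absolutely_continuous_pmf_iff:
  "absolutely_continuous (measure_pmf P) (measure_pmf Q) \<longleftrightarrow> set_pmf Q \<subseteq> set_pmf P"
proof
  assume ac: "absolutely_continuous (measure_pmf P) (measure_pmf Q)"
  show "set_pmf Q \<subseteq> set_pmf P"
  proof
    fix x assume x: "x \<in> set_pmf Q"
    show "x \<in> set_pmf P"
    proof (rule ccontr)
      assume "x \<notin> set_pmf P"
      then have "{x} \<in> null_sets (measure_pmf P)"
        by (simp add: null_sets_def emeasure_pmf_single pmf_eq_0_set_pmf)
      with ac have "{x} \<in> null_sets (measure_pmf Q)"
        by (auto simp: absolutely_continuous_def)
      with x show False
        by (simp add: null_sets_def emeasure_pmf_single pmf_eq_0_set_pmf)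
    qed
  qed
next
  assume sub: "set_pmf Q \<subseteq> set_pmf P"
  have "A \<in> null_sets (measure_pmf Q)" if "A \<in> null_sets (measure_pmf P)" for A
  proof -
    from that have "set_pmf P \<inter> A = {}"
      by (auto simp: null_sets_def measure_pmf.emeasure_eq_measure measure_pmf_zero_iff)
    with sub show ?thesis
      by (auto simp: null_sets_def measure_pmf.emeasure_eq_measure measure_pmf_zero_iff)
  qed
  then show "absolutely_continuous (measure_pmf P) (measure_pmf Q)"
    by (auto simp: absolutely_continuous_def)
qed

lemma kl_div_eq_sum:
  fixes P Q :: "'a::finite pmf"
  shows "kl_div Q P =
    (if set_pmf Q \<subseteq> set_pmf P
     then ereal (\<Sum>x\<in>UNIV. pmf Q x * ln (pmf Q x / pmf P x)) else \<infinity>)"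
proof (cases "set_pmf Q \<subseteq> set_pmf P")
  case True
  interpret sigma_finite_measure "count_space (UNIV :: 'a set)"
    by (rule sigma_finite_measure_count_space)
  have "KL_divergence (exp 1) (measure_pmf P) (measure_pmf Q) =
      KL_divergence (exp 1) (density (count_space UNIV) (\<lambda>x. ennreal (pmf P x)))
        (density (count_space UNIV) (\<lambda>x. ennreal (pmf Q x)))"
    by (simp add: measure_pmf_eq_density[symmetric])
  also have "\<dots> = (\<integral>x. pmf Q x * log (exp 1) (pmf Q x / pmf P x) \<partial>count_space UNIV)"
    using True by (intro KL_density_density) (auto simp: AE_count_space pmf_eq_0_set_pmf)
  also have "\<dots> = (\<Sum>x\<in>UNIV. pmf Q x * ln (pmf Q x / pmf P x))"
    by (simp add: lebesgue_integral_count_space_finite log_def)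
  finally show ?thesis
    using True by (simp add: kl_div_def absolutely_continuous_pmf_iff)
qed (simp add: kl_div_def absolutely_continuous_pmf_iff)

lemma shannon_entropy_eq_sum:
  fixes Q :: "'a::finite pmf"
  shows "shannon_entropy Q = - (\<Sum>x\<in>UNIV. pmf Q x * ln (pmf Q x))"
proof -
  interpret sigma_finite_measure "count_space (UNIV :: 'a set)"
    by (rule sigma_finite_measure_count_space)
  have "distr (measure_pmf Q) (count_space UNIV) (\<lambda>x. x) = measure_pmf Q"
    by (intro measure_eqI) (auto simp: emeasure_distr)
  then have "shannon_entropy Q = - KL_divergence (exp 1) (count_space UNIV) (measure_pmf Q)"
    by (simp add: shannon_entropy_def prob_space.entropy_def[OF prob_space_measure_pmf])
  also have "KL_divergence (exp 1) (count_space UNIV) (measure_pmf Q) =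
      KL_divergence (exp 1) (count_space UNIV) (density (count_space UNIV) (\<lambda>x. ennreal (pmf Q x)))"
    by (simp add: measure_pmf_eq_density[symmetric])
  also have "\<dots> = (\<integral>x. pmf Q x * log (exp 1) (pmf Q x) \<partial>count_space UNIV)"
    by (intro KL_density) (auto simp: AE_count_space)
  also have "\<dots> = (\<Sum>x\<in>UNIV. pmf Q x * ln (pmf Q x))"
    by (simp add: lebesgue_integral_count_space_finite log_def)
  finally show ?thesis .
qed

lemma dual_expr_tendsto:
  fixes P :: "'a::finite pmf"
  shows "(dual_expr P E0 \<longlongrightarrow> - ln (MAX x. pmf P x) - E0) (at_right 0)"
proof -
  define m where "m = (MAX x. pmf P x)"
  have le_m: "pmf P x \<le> m" for x
    unfolding m_def by (intro Max_ge) auto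
  obtain z where z: "pmf P z = m"
    using Max_in[of "range (pmf P)"] unfolding m_def by (fastforce simp: image_iff)
  obtain y where "y \<in> set_pmf P"
    using set_pmf_not_empty[of P] by blast
  then have m_pos: "0 < m"
    using le_m[of y] pmf_positive[of y P] by linarith
  define S where "S l = (\<Sum>x\<in>UNIV. pmf P x powr (1 + 1 / l))" for l :: real
  have lower: "m powr (1 + 1 / l) \<le> S l" for l
    unfolding S_def z[symmetric] by (intro member_le_sum) auto
  have upper: "S l \<le> m powr (1 / l)" if "0 < l" for l
  proof -
    have "S l = (\<Sum>x\<in>UNIV. pmf P x * pmf P x powr (1 / l))"
      unfolding S_def by (intro sum.cong refl) (simp add: powr_add)
    also have "\<dots> \<le> (\<Sum>x\<in>UNIV. pmf P x * m powr (1 / l))"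
      using that le_m by (intro sum_mono mult_left_mono powr_mono2) auto
    also have "\<dots> = m powr (1 / l)"
      by (simp add: sum_distrib_right[symmetric] sum_pmf_eq_1)
    finally show ?thesis .
  qed
  have bounds: "- ln m - (1 + l) * E0 \<le> dual_expr P E0 l \<and>
      dual_expr P E0 l \<le> - (l + 1) * ln m - (1 + l) * E0" if "0 < l" for l
  proof -
    have S_pos: "0 < S l"
      using lower[of l] m_pos by (smt (verit) powr_gt_zero)
    have "ln (S l) \<le> ln (m powr (1 / l))"
      using upper[OF that] S_pos by (rule ln_mono)
    then have "l * ln (S l) \<le> l * (1 / l * ln m)"
      using that by (intro mult_left_mono) (auto simp: m_pos ln_powr)
    moreover have "ln (m powr (1 + 1 / l)) \<le> ln (S l)"
      using lower[of l] m_pos by (intro ln_mono) auto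
    then have "l * ((1 + 1 / l) * ln m) \<le> l * ln (S l)"
      using that m_pos by (intro mult_left_mono) (auto simp: ln_powr)
    moreover have "l * (1 / l * ln m) = ln m" "l * ((1 + 1 / l) * ln m) = (l + 1) * ln m"
      using that by (auto simp: field_simps)
    ultimately show ?thesis
      unfolding dual_expr_def S_def[symmetric] by (simp add: algebra_simps)
  qed
  show ?thesis
    unfolding m_def[symmetric]
  proof (rule tendsto_sandwich)
    show "\<forall>\<^sub>F l in at_right 0. - ln m - (1 + l) * E0 \<le> dual_expr P E0 l"
      using bounds by (auto simp: eventually_at_filter)
    show "\<forall>\<^sub>F l in at_right 0. dual_expr P E0 l \<le> - (l + 1) * ln m - (1 + l) * E0"
      using bounds by (auto simp: eventually_at_filter)
    have "((\<lambda>l. - ln m - (1 + l) * E0) \<longlongrightarrow> - ln m - (1 + 0) * E0) (at_right 0)"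
      by (intro tendsto_intros)
    then show "((\<lambda>l. - ln m - (1 + l) * E0) \<longlongrightarrow> - ln m - E0) (at_right 0)"
      by simp
    have "((\<lambda>l. - (l + 1) * ln m - (1 + l) * E0) \<longlongrightarrow> - (0 + 1) * ln m - (1 + 0) * E0) (at_right 0)"
      by (intro tendsto_intros)
    then show "((\<lambda>l. - (l + 1) * ln m - (1 + l) * E0) \<longlongrightarrow> - ln m - E0) (at_right 0)"
      by simp
  qed
qed

end

theory Submission
  imports Defs "HOL-Real_Asymp.Real_Asymp"
begin

text \<open>
  Write \<open>L(Q) = E\<^sub>Q ln (1/P)\<close>, so that \<open>D(Q || P) = L(Q) - H(Q)\<close>. The condition on the objective at \<open>Q\<close> is
  automatic if \<open>D \<ge> E\<^sub>0\<close>, and for \<open>D < E\<^sub>0\<close> it says \<open>R\<^sub>s \<ge> E\<^sub>0 - D\<close> and \<open>R\<^sub>w \<le> L(Q) - E\<^sub>0\<close>; the points with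
  \<open>D = E\<^sub>0\<close> are reached by mixing \<open>Q\<close> with \<open>P\<close>, where \<open>L\<close> is affine and \<open>D\<close> is convex.
  For the dual formula, let \<open>T\<^sub>s\<close> be proportional to \<open>P\<^sup>s\<close> with \<open>s = 1 + 1/\<lambda>\<close>. Gibbs' inequality against
  \<open>T\<^sub>s\<close> shows that \<open>L + \<lambda> D\<close> is minimised by \<open>T\<^sub>s\<close>, which is weak duality. Either \<open>D(T\<^sub>s || P) = E\<^sub>0\<close> for some
  \<open>s\<close>, and there is no gap, or \<open>D(T\<^sub>s || P) < E\<^sub>0\<close> for all \<open>s\<close>, and the gap at \<open>T\<^sub>s\<close> is at most \<open>\<lambda> E\<^sub>0\<close>,
  which vanishes as \<open>\<lambda>\<close> tends to 0.
\<close>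

section \<open>Information quantities as real sums\<close>

text \<open>Because \<open>ln 0 = 0\<close>, this real number agrees with
  \<open>expected_log_inv\<close> exactly when the support of \<open>Q\<close> lies in that of
  \<open>P\<close>; otherwise the latter is infinite.\<close>

definition cross_entropy :: "'a::finite pmf \<Rightarrow> 'a pmf \<Rightarrow> real" where
  "cross_entropy Q P = - (\<Sum>x\<in>UNIV. pmf Q x * ln (pmf P x))"

lemma shannon_entropy_eq_cross_entropy: "shannon_entropy Q = cross_entropy Q Q"
  by (simp add: shannon_entropy_eq_sum cross_entropy_def)

lemma kl_div_eq_cross_entropy:
  assumes "set_pmf Q \<subseteq> set_pmf P"
  shows "kl_div Q P = ereal (cross_entropy Q P - shannon_entropy Q)"
proof -
  have "pmf Q x * ln (pmf Q x / pmf P x) = pmf Q x * ln (pmf Q x) - pmf Q x * ln (pmf P x)" for x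
  proof (cases "x \<in> set_pmf Q")
    case True
    with assms have "pmf Q x > 0" "pmf P x > 0"
      by (auto intro: pmf_positive)
    then show ?thesis by (simp add: ln_div right_diff_distrib)
  qed (simp add: set_pmf_iff)
  then show ?thesis
    using assms
    by (simp add: kl_div_eq_sum cross_entropy_def shannon_entropy_eq_sum sum_subtractf)
qed

lemma kl_div_eq_infinity: "\<not> set_pmf Q \<subseteq> set_pmf P \<Longrightarrow> kl_div Q P = \<infinity>"
  by (simp add: kl_div_eq_sum)

lemma expected_log_inv_eq_cross_entropy:
  assumes "set_pmf Q \<subseteq> set_pmf P"
  shows "expected_log_inv Q P = ereal (cross_entropy Q P)"
proof -
  have "ereal (pmf Q x) * (if pmf P x = 0 then \<infinity> else ereal (ln (1 / pmf P x)))
      = ereal (- (pmf Q x * ln (pmf P x)))" for x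
  proof (cases "x \<in> set_pmf Q")
    case True
    with assms have "pmf P x > 0"
      by (auto intro: pmf_positive)
    then show ?thesis by (simp add: ln_div)
  qed (simp add: set_pmf_iff zero_ereal_def[symmetric])
  then show ?thesis
    by (simp add: expected_log_inv_def cross_entropy_def sum_negf)
qed

text \<open>Sum \<open>ln t \<le> t - 1\<close> at \<open>t = M/Q\<close>, weighted by
  \<open>Q\<close>; both distributions have mass 1. This one inequality yields nonnegative
  divergence, concave entropy and weak duality.\<close>

lemma gibbs_inequality:
  assumes "set_pmf Q \<subseteq> set_pmf M"
  shows "shannon_entropy Q \<le> cross_entropy Q M"
proof -
  have "pmf Q x * ln (pmf M x) - pmf Q x * ln (pmf Q x) \<le> pmf M x - pmf Q x" for x
  proof (cases "x \<in> set_pmf Q")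
    case True
    with assms have pos: "pmf Q x > 0" "pmf M x > 0"
      by (auto intro: pmf_positive)
    then have "ln (pmf M x / pmf Q x) \<le> pmf M x / pmf Q x - 1"
      by (intro ln_le_minus_one) simp
    then have "pmf Q x * ln (pmf M x / pmf Q x) \<le> pmf Q x * (pmf M x / pmf Q x - 1)"
      using pos by (intro mult_left_mono) auto
    with pos show ?thesis by (simp add: ln_div right_diff_distrib)
  qed (simp add: set_pmf_iff)
  then have "(\<Sum>x\<in>UNIV. pmf Q x * ln (pmf M x) - pmf Q x * ln (pmf Q x))
      \<le> (\<Sum>x\<in>UNIV. pmf M x - pmf Q x)"
    by (intro sum_mono)
  then show ?thesis
    by (simp add: sum_subtractf sum_pmf_eq_1 shannon_entropy_eq_sum cross_entropy_def)
qed

section \<open>Mixtures of distributions\<close>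

lemma exists_pmf_finite:
  fixes f :: "'a::finite \<Rightarrow> real"
  assumes "\<And>x. f x \<ge> 0" and "(\<Sum>x\<in>UNIV. f x) = 1"
  obtains Q where "\<And>x. pmf Q x = f x"
proof -
  have "(\<integral>\<^sup>+x. ennreal (f x) \<partial>count_space UNIV) = 1"
    using assms by (simp add: nn_integral_count_space_finite)
  then have "pmf (embed_pmf f) x = f x" for x
    using assms(1) by (intro pmf_embed_pmf) auto
  then show ?thesis by (rule that)
qed

lemma exists_pmf_mixture:
  fixes P Q :: "'a::finite pmf"
  assumes "0 < t" and "t < 1"
  obtains M where "\<And>x. pmf M x = (1 - t) * pmf Q x + t * pmf P x"
    and "set_pmf M = set_pmf Q \<union> set_pmf P"
proof -
  have "(\<Sum>x\<in>UNIV. (1 - t) * pmf Q x + t * pmf P x) = 1"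
    by (simp add: sum.distrib sum_distrib_left[symmetric] sum_pmf_eq_1)
  moreover have "(1 - t) * pmf Q x + t * pmf P x \<ge> 0" for x
    using assms by simp
  ultimately obtain M where M: "\<And>x. pmf M x = (1 - t) * pmf Q x + t * pmf P x"
    using exists_pmf_finite[of "\<lambda>x. (1 - t) * pmf Q x + t * pmf P x"] by blast
  moreover have "(1 - t) * pmf Q x + t * pmf P x = 0 \<longleftrightarrow> pmf Q x = 0 \<and> pmf P x = 0" for x
    using assms by (subst add_nonneg_eq_0_iff) auto
  then have "set_pmf M = set_pmf Q \<union> set_pmf P"
    by (auto simp: set_pmf_iff M)
  ultimately show ?thesis by (rule that)
qed

lemma cross_entropy_mixture:
  assumes "\<And>x. pmf M x = (1 - t) * pmf Q x + t * pmf P x"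
  shows "cross_entropy M R = (1 - t) * cross_entropy Q R + t * cross_entropy P R"
  by (simp add: cross_entropy_def assms algebra_simps sum.distrib sum_subtractf sum_distrib_left)

text \<open>The entropy of \<open>M\<close> is its cross entropy against itself, which is affine in
  the first argument; Gibbs' inequality against \<open>M\<close> then applies to \<open>Q\<close>
  and \<open>P\<close> separately.\<close>

lemma shannon_entropy_mixture_ge:
  assumes "\<And>x. pmf M x = (1 - t) * pmf Q x + t * pmf P x"
    and "set_pmf M = set_pmf Q \<union> set_pmf P" and "0 < t" and "t < 1"
  shows "(1 - t) * shannon_entropy Q + t * shannon_entropy P \<le> shannon_entropy M"
  unfolding shannon_entropy_eq_cross_entropy[of M] cross_entropy_mixture[OF assms(1)]
  using assms by (intro add_mono mult_left_mono gibbs_inequality) auto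

section \<open>Tilted distributions\<close>

text \<open>As \<open>0 powr s = 0\<close> for every real \<open>s\<close>, only the support of
  \<open>P\<close> contributes, and tilting preserves that support.\<close>

definition partition_sum :: "'a::finite pmf \<Rightarrow> real \<Rightarrow> real" where
  "partition_sum P s = (\<Sum>x\<in>UNIV. pmf P x powr s)"

lemma partition_sum_pos: "partition_sum P s > 0"
proof -
  obtain y where "y \<in> set_pmf P"
    using set_pmf_not_empty[of P] by blast
  then show ?thesis
    unfolding partition_sum_def by (intro sum_pos2[of _ y]) (auto simp: set_pmf_iff)
qed

definition tilted_pmf :: "'a::finite pmf \<Rightarrow> real \<Rightarrow> 'a pmf" where
  "tilted_pmf P s = embed_pmf (\<lambda>x. pmf P x powr s / partition_sum P s)"

lemma pmf_tilted_pmf: "pmf (tilted_pmf P s) x = pmf P x powr s / partition_sum P s"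
proof -
  have "(\<Sum>x\<in>UNIV. pmf P x powr s / partition_sum P s) = 1"
    using partition_sum_pos[of P s]
    by (simp add: sum_divide_distrib[symmetric] partition_sum_def[symmetric])
  then have "(\<integral>\<^sup>+x. ennreal (pmf P x powr s / partition_sum P s) \<partial>count_space UNIV) = 1"
    using partition_sum_pos[of P s] by (simp add: nn_integral_count_space_finite)
  then show ?thesis
    unfolding tilted_pmf_def using partition_sum_pos[of P s] by (intro pmf_embed_pmf) auto
qed

lemma set_pmf_tilted_pmf [simp]: "set_pmf (tilted_pmf P s) = set_pmf P"
  using partition_sum_pos[of P s] by (auto simp: set_pmf_iff pmf_tilted_pmf)

text \<open>On the support of \<open>P\<close>, the log of the tilted mass is
  \<open>s * ln (pmf P x)\<close> minus a constant, the log of the partition sum.\<close>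

lemma cross_entropy_tilted_pmf:
  assumes "set_pmf Q \<subseteq> set_pmf P"
  shows "cross_entropy Q (tilted_pmf P s) = s * cross_entropy Q P + ln (partition_sum P s)"
proof -
  have "pmf Q x * ln (pmf (tilted_pmf P s) x)
      = s * (pmf Q x * ln (pmf P x)) - pmf Q x * ln (partition_sum P s)" for x
  proof (cases "x \<in> set_pmf Q")
    case True
    with assms have "pmf P x > 0"
      by (auto intro: pmf_positive)
    then show ?thesis
      using partition_sum_pos[of P s]
      by (simp add: pmf_tilted_pmf ln_div ln_powr algebra_simps)
  qed (simp add: set_pmf_iff)
  then show ?thesis
    by (simp add: cross_entropy_def sum_subtractf sum_distrib_left[symmetric]
        sum_distrib_right[symmetric] sum_pmf_eq_1)
qed

lemma shannon_entropy_tilted_pmf: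
  "shannon_entropy (tilted_pmf P s)
    = s * cross_entropy (tilted_pmf P s) P + ln (partition_sum P s)"
  by (simp add: shannon_entropy_eq_cross_entropy cross_entropy_tilted_pmf)

section \<open>Lagrangian and weak duality\<close>

lemma dual_expr_eq: "dual_expr P E0 l = - l * ln (partition_sum P (1 + 1 / l)) - (1 + l) * E0"
  by (simp add: dual_expr_def partition_sum_def)

text \<open>The right side is the Lagrangian of minimising \<open>L(Q) - E0\<close> subject to
  \<open>D \<le> E0\<close>, with multiplier \<open>l\<close>. The bound is \<open>l\<close> times
  Gibbs' inequality against the tilt \<open>s = 1 + 1/l\<close>.\<close>

lemma dual_expr_le_lagrangian:
  assumes "set_pmf Q \<subseteq> set_pmf P" and "l > 0"
  shows "dual_expr P E0 l
    \<le> cross_entropy Q P - E0 + l * (cross_entropy Q P - shannon_entropy Q - E0)"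
proof -
  have "shannon_entropy Q \<le> (1 + 1 / l) * cross_entropy Q P + ln (partition_sum P (1 + 1 / l))"
    unfolding cross_entropy_tilted_pmf[OF assms(1), symmetric]
    using assms(1) by (intro gibbs_inequality) simp
  then have "l * shannon_entropy Q
      \<le> l * ((1 + 1 / l) * cross_entropy Q P + ln (partition_sum P (1 + 1 / l)))"
    using assms(2) by (intro mult_left_mono) auto
  with assms(2) show ?thesis
    by (simp add: dual_expr_eq algebra_simps)
qed

text \<open>Equality case of the previous bound: Gibbs' inequality is tight when both arguments are
  the tilted distribution.\<close>

lemma dual_expr_eq_lagrangian_tilted_pmf:
  assumes "l > 0" and "T = tilted_pmf P (1 + 1 / l)"
  shows "dual_expr P E0 l
    = cross_entropy T P - E0 + l * (cross_entropy T P - shannon_entropy T - E0)"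
proof -
  have "shannon_entropy T = (1 + 1 / l) * cross_entropy T P + ln (partition_sum P (1 + 1 / l))"
    unfolding assms(2) by (rule shannon_entropy_tilted_pmf)
  then have "l * shannon_entropy T
      = l * ((1 + 1 / l) * cross_entropy T P + ln (partition_sum P (1 + 1 / l)))"
    by simp
  with assms(1) show ?thesis
    by (simp add: dual_expr_eq algebra_simps)
qed

text \<open>For a feasible \<open>Q\<close> the penalty term of the Lagrangian is nonpositive; the
  bound for positive multipliers passes to the limit at 0.\<close>

lemma dual_objective_le:
  assumes "set_pmf Q \<subseteq> set_pmf P" and "cross_entropy Q P - shannon_entropy Q \<le> E0" and "l \<ge> 0"
  shows "dual_objective P E0 l \<le> cross_entropy Q P - E0"
proof -
  have pos: "dual_expr P E0 k \<le> cross_entropy Q P - E0" if "k > 0" for k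
  proof -
    have "k * (cross_entropy Q P - shannon_entropy Q - E0) \<le> 0"
      using assms(2) that by (intro mult_nonneg_nonpos) auto
    with dual_expr_le_lagrangian[OF assms(1) that, of E0] show ?thesis by linarith
  qed
  have "Lim (at_right 0) (dual_expr P E0) = - ln (MAX x. pmf P x) - E0"
    by (intro tendsto_Lim dual_expr_tendsto) simp
  moreover have "\<forall>\<^sub>F k in at_right 0. dual_expr P E0 k \<le> cross_entropy Q P - E0"
    using pos by (auto simp: eventually_at_filter)
  then have "- ln (MAX x. pmf P x) - E0 \<le> cross_entropy Q P - E0"
    by (intro tendsto_upperbound[OF dual_expr_tendsto]) auto
  ultimately show ?thesis
    using pos assms(3) by (auto simp: dual_objective_def)
qed

section \<open>Continuity in the tilt and strong duality\<close>

lemma continuous_on_pmf_powr: "continuous_on A (\<lambda>s. pmf P x powr s)"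
  by (cases "pmf P x = 0") (auto intro!: continuous_intros)

lemma continuous_on_partition_sum: "continuous_on A (partition_sum P)"
  unfolding partition_sum_def by (intro continuous_on_sum continuous_on_pmf_powr)

lemma continuous_on_cross_entropy_tilted_pmf:
  "continuous_on A (\<lambda>s. cross_entropy (tilted_pmf P s) P)"
  unfolding cross_entropy_def pmf_tilted_pmf
  using less_imp_neq[OF partition_sum_pos[of P]]
  by (intro continuous_on_minus continuous_on_sum continuous_on_mult continuous_on_divide
      continuous_on_const continuous_on_pmf_powr continuous_on_partition_sum) force

lemma continuous_on_divergence_tilted_pmf:
  "continuous_on A
    (\<lambda>s. cross_entropy (tilted_pmf P s) P - shannon_entropy (tilted_pmf P s))"
  unfolding shannon_entropy_tilted_pmf
  using less_imp_neq[OF partition_sum_pos[of P]]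
  by (intro continuous_intros continuous_on_partition_sum continuous_on_cross_entropy_tilted_pmf)
    auto

lemma tilted_pmf_1: "tilted_pmf P 1 = P"
  by (intro pmf_eqI) (simp add: pmf_tilted_pmf partition_sum_def sum_pmf_eq_1)

lemma strong_duality:
  assumes "E0 > 0" and "e > 0"
  obtains l T where "l > 0" and "set_pmf T \<subseteq> set_pmf P"
    and "cross_entropy T P - shannon_entropy T \<le> E0"
    and "cross_entropy T P - E0 \<le> dual_expr P E0 l + e"
proof -
  define D where "D s = cross_entropy (tilted_pmf P s) P - shannon_entropy (tilted_pmf P s)" for s
  \<comment> \<open>The multiplier \<open>1 / (s - 1)\<close> inverts \<open>s = 1 + 1/l\<close>;
    the last summand is the duality gap to be made small.\<close>
  have gap: "cross_entropy (tilted_pmf P s) P - E0 = dual_expr P E0 (1 / (s - 1)) + (E0 - D s) / (s - 1)"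
    if "s > 1" for s
    using dual_expr_eq_lagrangian_tilted_pmf[of "1 / (s - 1)" "tilted_pmf P s" P E0] that
    by (simp add: D_def field_simps)
  have D1: "D 1 = 0"
    by (simp add: D_def tilted_pmf_1 shannon_entropy_eq_cross_entropy)
  \<comment> \<open>Chosen so that \<open>E0 / (r - 1) = e\<close>, the largest gap the tilt
    \<open>r\<close> can have when its divergence lies between 0 and \<open>E0\<close>.\<close>
  define r where "r = 1 + E0 / e"
  have r: "r > 1"
    using assms by (simp add: r_def)
  obtain s where s: "s > 1" "D s \<le> E0" "(E0 - D s) / (s - 1) \<le> e"
  proof (cases "D r \<ge> E0")
    case True
    \<comment> \<open>The divergence starts at 0 for \<open>s = 1\<close>, so it crosses
      \<open>E0\<close> by \<open>r\<close>; the gap there is zero.\<close>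
    then obtain s where "1 \<le> s" "D s = E0"
      using IVT'[of D 1 E0 r] D1 r assms(1) continuous_on_divergence_tilted_pmf[of "{1..r}" P]
      by (auto simp: D_def)
    moreover from this D1 assms(1) have "s \<noteq> 1" by auto
    ultimately show ?thesis
      using assms(2) by (intro that[of s]) auto
  next
    case False
    have "D r \<ge> 0"
      by (simp add: D_def gibbs_inequality)
    then have "(E0 - D r) / (r - 1) \<le> E0 / (r - 1)"
      using r by (intro divide_right_mono) auto
    also have "\<dots> = e"
      using assms by (simp add: r_def)
    finally show ?thesis
      using False r by (intro that[of r]) auto
  qed
  show ?thesis
    by (rule that[of "1 / (s - 1)" "tilted_pmf P s"]) (use s gap[OF s(1)] in \<open>auto simp: D_def\<close>)
qed

section \<open>Compactness\<close>

text \<open>Coordinates in which the distributions form the probability simplex of Euclidean space,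
  so that Heine-Borel applies.\<close>

definition pmf_vec :: "'a::finite pmf \<Rightarrow> real ^ 'a" where
  "pmf_vec Q = (\<chi> x. pmf Q x)"

lemma compact_range_pmf_vec: "compact (range (pmf_vec :: 'a::finite pmf \<Rightarrow> _))"
proof -
  have "range (pmf_vec :: 'a pmf \<Rightarrow> _) = {v. (\<forall>x. 0 \<le> v $ x) \<and> (\<Sum>x\<in>UNIV. v $ x) = 1}"
  proof (intro equalityI subsetI)
    fix v :: "real ^ 'a"
    assume "v \<in> {v. (\<forall>x. 0 \<le> v $ x) \<and> (\<Sum>x\<in>UNIV. v $ x) = 1}"
    then obtain Q where "\<And>x. pmf Q x = v $ x"
      using exists_pmf_finite[of "\<lambda>x. v $ x"] by auto
    then have "v = pmf_vec Q"
      by (simp add: pmf_vec_def vec_eq_iff)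
    then show "v \<in> range pmf_vec" by blast
  qed (auto simp: pmf_vec_def sum_pmf_eq_1)
  moreover have "closed {v :: real ^ 'a. (\<forall>x. 0 \<le> v $ x) \<and> (\<Sum>x\<in>UNIV. v $ x) = 1}"
    by (intro closed_Collect_conj closed_Collect_all closed_Collect_le closed_Collect_eq
        continuous_intros)
  moreover have "bounded (range (pmf_vec :: 'a pmf \<Rightarrow> _))"
  proof (rule bounded_subset[OF bounded_cbox])
    show "range pmf_vec \<subseteq> cbox 0 (1 :: real ^ 'a)"
      by (auto simp: pmf_vec_def mem_box_cart pmf_le_1)
  qed
  ultimately show ?thesis
    by (simp add: compact_eq_bounded_closed)
qed

text \<open>Away from 0 this is routine; at 0 the value \<open>0 * ln 0 = 0\<close> is the
  right-hand limit.\<close>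

lemma continuous_on_x_ln_x: "continuous_on {0..} (\<lambda>x::real. x * ln x)"
proof -
  have "((\<lambda>x::real. x * ln x) \<longlongrightarrow> 0) (at_right 0)"
    by real_asymp
  then have "((\<lambda>x::real. x * ln x) \<longlongrightarrow> 0 * ln 0) (at 0 within {0..})"
    by (simp add: at_within_Ici_at_right)
  moreover have "((\<lambda>x. x * ln x) \<longlongrightarrow> x * ln x) (at x within {0..})" if "x > 0" for x :: real
    using that by (intro tendsto_intros) auto
  ultimately show ?thesis
    unfolding continuous_on_def by (metis atLeast_iff order_le_less)
qed

lemma continuous_on_entropy_vec:
  "continuous_on (range pmf_vec) (\<lambda>v. - (\<Sum>x\<in>UNIV. v $ x * ln (v $ x)))"
proof -
  have "continuous_on (range pmf_vec) (\<lambda>v. v $ x * ln (v $ x))" for x :: 'a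
    by (rule continuous_on_compose2[OF continuous_on_x_ln_x])
      (auto intro!: continuous_intros simp: pmf_vec_def)
  then show ?thesis
    by (intro continuous_on_minus continuous_on_sum)
qed

text \<open>On distributions supported in that of \<open>P\<close>, both minimisation problems
  depend on \<open>Q\<close> only through the pair \<open>(L, H)\<close>, so one compact planar set
  serves both.\<close>

lemma compact_information_region:
  fixes P :: "'a::finite pmf"
  shows "compact ((\<lambda>Q. (cross_entropy Q P, shannon_entropy Q)) ` {Q. set_pmf Q \<subseteq> set_pmf P})"
proof -
  \<comment> \<open>The closed face of the simplex formed by distributions whose support lies in
    that of \<open>P\<close>.\<close>
  define K where "K = range (pmf_vec :: 'a pmf \<Rightarrow> _) \<inter> {v. \<forall>x\<in>- set_pmf P. v $ x = 0}"
  define g where "g v = (- (\<Sum>x\<in>UNIV. v $ x * ln (pmf P x)), - (\<Sum>x\<in>UNIV. v $ x * ln (v $ x)))"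
    for v :: "real ^ 'a"
  have "closed {v :: real ^ 'a. \<forall>x\<in>- set_pmf P. v $ x = 0}"
    unfolding Ball_def
    by (intro closed_Collect_all closed_Collect_imp closed_Collect_eq continuous_intros) auto
  then have "compact K"
    unfolding K_def by (intro compact_Int_closed compact_range_pmf_vec)
  moreover have "continuous_on K g"
    unfolding g_def
    by (intro continuous_intros continuous_on_subset[OF continuous_on_entropy_vec])
      (auto simp: K_def)
  ultimately have "compact (g ` K)"
    by (intro compact_continuous_image)
  moreover have "(\<forall>x\<in>- set_pmf P. pmf_vec Q $ x = 0) \<longleftrightarrow> set_pmf Q \<subseteq> set_pmf P" for Q
    by (auto simp: pmf_vec_def set_pmf_iff)
  then have "K = pmf_vec ` {Q. set_pmf Q \<subseteq> set_pmf P}"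
    unfolding K_def by blast
  then have "g ` K = (\<lambda>Q. (cross_entropy Q P, shannon_entropy Q)) ` {Q. set_pmf Q \<subseteq> set_pmf P}"
    by (simp add: image_image g_def pmf_vec_def cross_entropy_def shannon_entropy_eq_sum)
  ultimately show ?thesis by simp
qed

section \<open>Attainment of the minima\<close>

lemma fa_objective_eq:
  assumes "set_pmf Q \<subseteq> set_pmf P"
  shows "fa_objective P Rw Rs Q = ereal (cross_entropy Q P - shannon_entropy Q
    + min Rs (max 0 (shannon_entropy Q - Rw)))"
  unfolding fa_objective_def kl_div_eq_cross_entropy[OF assms] plus_ereal.simps(1) ..

lemma fa_objective_eq_infinity:
  "\<not> set_pmf Q \<subseteq> set_pmf P \<Longrightarrow> fa_objective P Rw Rs Q = \<infinity>"
  by (simp add: fa_objective_def kl_div_eq_infinity)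

text \<open>The objective is continuous in \<open>(L, H)\<close> on the compact region and infinite
  for all other \<open>Q\<close>.\<close>

lemma exists_E_FA_minimizer: "\<exists>Q. fa_objective P Rw Rs Q = E_FA P Rw Rs"
proof -
  let ?K = "(\<lambda>Q. (cross_entropy Q P, shannon_entropy Q)) ` {Q. set_pmf Q \<subseteq> set_pmf P}"
  have "continuous_on ?K (\<lambda>z. fst z - snd z + min Rs (max 0 (snd z - Rw)))"
    by (intro continuous_intros)
  moreover have "?K \<noteq> {}" by auto
  ultimately obtain z where z: "z \<in> ?K" "\<forall>y\<in>?K. fst z - snd z + min Rs (max 0 (snd z - Rw))
      \<le> fst y - snd y + min Rs (max 0 (snd y - Rw))"
    using continuous_attains_inf[OF compact_information_region[of P]] by blast
  then obtain Q where Q: "set_pmf Q \<subseteq> set_pmf P" "z = (cross_entropy Q P, shannon_entropy Q)"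
    by blast
  have min:
    "\<And>Q'. set_pmf Q' \<subseteq> set_pmf P \<Longrightarrow>
      cross_entropy Q P - shannon_entropy Q + min Rs (max 0 (shannon_entropy Q - Rw))
      \<le> cross_entropy Q' P - shannon_entropy Q' + min Rs (max 0 (shannon_entropy Q' - Rw))"
    using bspec[OF z(2) imageI] by (simp add: Q(2))
  have "fa_objective P Rw Rs Q \<le> fa_objective P Rw Rs Q'" for Q'
    using Q(1) min
    by (cases "set_pmf Q' \<subseteq> set_pmf P") (simp_all add: fa_objective_eq fa_objective_eq_infinity)
  then have "fa_objective P Rw Rs Q = E_FA P Rw Rs"
    unfolding E_FA_def by (intro INF_eqI[symmetric]) auto
  then show ?thesis by blast
qed

lemma kl_div_le_iff:
  "kl_div Q P \<le> ereal E \<longleftrightarrow>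
    set_pmf Q \<subseteq> set_pmf P \<and> cross_entropy Q P - shannon_entropy Q \<le> E"
  by (cases "set_pmf Q \<subseteq> set_pmf P") (auto simp: kl_div_eq_cross_entropy kl_div_eq_infinity)

text \<open>In the plane the divergence constraint is a closed half-plane, which meets the region at
  the point of \<open>P\<close>; minimise the first coordinate there.\<close>

lemma exists_Rw_star_minimizer:
  assumes "E0 > 0"
  obtains Q where "kl_div Q P \<le> ereal E0" and "Rw_star P E0 = ereal (cross_entropy Q P - E0)"
    and "\<And>Q'. kl_div Q' P \<le> ereal E0 \<Longrightarrow> cross_entropy Q P \<le> cross_entropy Q' P"
proof -
  let ?K = "(\<lambda>Q. (cross_entropy Q P, shannon_entropy Q)) ` {Q. set_pmf Q \<subseteq> set_pmf P}"
  let ?C = "{z :: real \<times> real. fst z - snd z \<le> E0}"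
  have "compact (?K \<inter> ?C)"
    by (intro compact_Int_closed compact_information_region closed_Collect_le continuous_on_diff
        continuous_on_fst continuous_on_snd continuous_on_id continuous_on_const)
  moreover have "(cross_entropy P P, shannon_entropy P) \<in> ?K \<inter> ?C"
    using assms by (intro IntI imageI) (simp_all add: shannon_entropy_eq_cross_entropy)
  then have "?K \<inter> ?C \<noteq> {}"
    by (metis empty_iff)
  moreover have "continuous_on (?K \<inter> ?C) fst"
    by (rule continuous_on_fst[OF continuous_on_id])
  ultimately have "\<exists>z\<in>?K \<inter> ?C. \<forall>y\<in>?K \<inter> ?C. fst z \<le> fst y"
    by (rule continuous_attains_inf)
  then obtain z where z: "z \<in> ?K \<inter> ?C" "\<forall>y\<in>?K \<inter> ?C. fst z \<le> fst y"
    by (elim bexE)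
  then obtain Q where Q: "kl_div Q P \<le> ereal E0" "z = (cross_entropy Q P, shannon_entropy Q)"
    by (auto simp: kl_div_le_iff)
  have min: "cross_entropy Q P \<le> cross_entropy Q' P" if "kl_div Q' P \<le> ereal E0" for Q'
    using that z(2)[rule_format, of "(cross_entropy Q' P, shannon_entropy Q')"]
    by (simp add: kl_div_le_iff Q(2))
  have eq: "expected_log_inv Q' P = ereal (cross_entropy Q' P)" if "kl_div Q' P \<le> ereal E0" for Q'
    using that by (simp add: kl_div_le_iff expected_log_inv_eq_cross_entropy)
  have "(INF Q\<in>{Q. kl_div Q P \<le> ereal E0}. expected_log_inv Q P) = ereal (cross_entropy Q P)"
    using Q(1) min by (intro INF_eqI) (auto simp: eq)
  then have "Rw_star P E0 = ereal (cross_entropy Q P - E0)"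
    by (simp add: Rw_star_def)
  with Q(1) min show ?thesis by (intro that)
qed

section \<open>Equivalence with the rate conditions\<close>

lemma Rw_star_ge_iff:
  assumes "E0 > 0"
  shows "ereal Rw \<le> Rw_star P E0 \<longleftrightarrow>
    (\<forall>Q. kl_div Q P \<le> ereal E0 \<longrightarrow> Rw \<le> cross_entropy Q P - E0)"
proof -
  obtain Q where Q: "kl_div Q P \<le> ereal E0" "Rw_star P E0 = ereal (cross_entropy Q P - E0)"
    "\<And>Q'. kl_div Q' P \<le> ereal E0 \<Longrightarrow> cross_entropy Q P \<le> cross_entropy Q' P"
    using exists_Rw_star_minimizer[OF assms] by blast
  have "(\<forall>Q'. kl_div Q' P \<le> ereal E0 \<longrightarrow> Rw \<le> cross_entropy Q' P - E0) \<longleftrightarrow> Rw \<le> cross_entropy Q P - E0"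
    using Q(1) by (meson Q(3) diff_right_mono order_trans)
  then show ?thesis by (simp add: Q(2))
qed

lemma E_FA_ge_iff:
  assumes "E0 > 0" and "Rs \<ge> 0"
  shows "E_FA P Rw Rs \<ge> ereal E0 \<longleftrightarrow> Rs \<ge> E0 \<and> ereal Rw \<le> Rw_star P E0"
proof
  assume "E_FA P Rw Rs \<ge> ereal E0"
  then have obj: "E0 \<le> cross_entropy Q P - shannon_entropy Q
      + min Rs (max 0 (shannon_entropy Q - Rw))" if "set_pmf Q \<subseteq> set_pmf P" for Q
    unfolding E_FA_def le_INF_iff fa_objective_eq[OF that, symmetric] ereal_less_eq(3)[symmetric]
    by blast
  \<comment> \<open>At \<open>Q = P\<close> the divergence vanishes, leaving a minimum that is at
    most \<open>Rs\<close>.\<close>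
  have "Rs \<ge> E0"
    using obj[of P] by (simp add: shannon_entropy_eq_cross_entropy)
  \<comment> \<open>The second summand must be at least \<open>E0 - D > 0\<close>, so the positive
    part is \<open>H - Rw\<close> itself, and \<open>D + H = L\<close>.\<close>
  have strict: "Rw \<le> cross_entropy Q P - E0"
    if "set_pmf Q \<subseteq> set_pmf P" "cross_entropy Q P - shannon_entropy Q < E0" for Q
    using obj[OF that(1)] that(2) by linarith
  have "Rw \<le> cross_entropy Q P - E0" if Q: "kl_div Q P \<le> ereal E0" for Q
  proof -
    \<comment> \<open>Mixing in \<open>P\<close>, whose divergence is 0, makes the constraint strict
      even if \<open>D = E0\<close>; \<open>t\<close> is then sent to 0.\<close>
    have mixture: "Rw \<le> (1 - t) * cross_entropy Q P + t * shannon_entropy P - E0"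
      if t: "0 < t" "t < 1" for t
    proof -
      obtain M where M: "\<And>x. pmf M x = (1 - t) * pmf Q x + t * pmf P x"
        "set_pmf M = set_pmf Q \<union> set_pmf P"
        using exists_pmf_mixture[OF t] by blast
      have L: "cross_entropy M P = (1 - t) * cross_entropy Q P + t * shannon_entropy P"
        by (simp add: cross_entropy_mixture[OF M(1)] shannon_entropy_eq_cross_entropy)
      have "(1 - t) * (cross_entropy Q P - shannon_entropy Q) \<le> (1 - t) * E0"
        using Q t by (intro mult_left_mono) (auto simp: kl_div_le_iff)
      also have "\<dots> < E0"
        using t assms(1) by simp
      finally have "cross_entropy M P - shannon_entropy M < E0"
        using shannon_entropy_mixture_ge[OF M t] by (simp add: L algebra_simps)
      moreover have "set_pmf M \<subseteq> set_pmf P"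
        using Q M(2) by (simp add: kl_div_le_iff)
      ultimately show ?thesis
        using strict[of M] by (simp add: L)
    qed
    have "((\<lambda>t. (1 - t) * cross_entropy Q P + t * shannon_entropy P - E0)
        \<longlongrightarrow> (1 - 0) * cross_entropy Q P + 0 * shannon_entropy P - E0) (at_right 0)"
      by (intro tendsto_intros)
    moreover have "\<forall>\<^sub>F t in at_right 0. Rw \<le> (1 - t) * cross_entropy Q P + t * shannon_entropy P - E0"
      by (rule eventually_at_rightI[of 0 1]) (use mixture in auto)
    ultimately have "Rw \<le> (1 - 0) * cross_entropy Q P + 0 * shannon_entropy P - E0"
      by (rule tendsto_lowerbound) simp
    then show ?thesis by simp
  qed
  with \<open>Rs \<ge> E0\<close> show "Rs \<ge> E0 \<and> ereal Rw \<le> Rw_star P E0"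
    by (simp add: Rw_star_ge_iff[OF assms(1)])
next
  assume R: "Rs \<ge> E0 \<and> ereal Rw \<le> Rw_star P E0"
  have "ereal E0 \<le> fa_objective P Rw Rs Q" for Q
  proof (cases "set_pmf Q \<subseteq> set_pmf P")
    case True
    have "Rw \<le> cross_entropy Q P - E0" if "cross_entropy Q P - shannon_entropy Q \<le> E0"
      using R True that by (simp add: Rw_star_ge_iff[OF assms(1)] kl_div_le_iff)
    \<comment> \<open>With \<open>D \<ge> 0\<close>, \<open>Rs \<ge> E0\<close> gives
      \<open>D + Rs \<ge> E0\<close>. The case \<open>D > E0\<close> follows from a nonnegative
      second summand.\<close>
    moreover have "shannon_entropy Q \<le> cross_entropy Q P"
      by (rule gibbs_inequality[OF True])
    ultimately have "E0 \<le> cross_entropy Q P - shannon_entropy Q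
        + min Rs (max 0 (shannon_entropy Q - Rw))"
      using R assms(2) by linarith
    then show ?thesis
      by (simp only: fa_objective_eq[OF True] ereal_less_eq)
  qed (simp add: fa_objective_eq_infinity)
  then show "E_FA P Rw Rs \<ge> ereal E0"
    unfolding E_FA_def by (intro INF_greatest)
qed

section \<open>Dual formula and conclusion\<close>

lemma Rw_star_eq_SUP_dual_objective:
  assumes "E0 > 0"
  shows "Rw_star P E0 = (SUP l\<in>{0..}. ereal (dual_objective P E0 l))"
proof -
  obtain Q where Q: "kl_div Q P \<le> ereal E0" "Rw_star P E0 = ereal (cross_entropy Q P - E0)"
    "\<And>Q'. kl_div Q' P \<le> ereal E0 \<Longrightarrow> cross_entropy Q P \<le> cross_entropy Q' P"
    using exists_Rw_star_minimizer[OF assms] by blast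
  show ?thesis
  proof (rule antisym)
    show "Rw_star P E0 \<le> (SUP l\<in>{0..}. ereal (dual_objective P E0 l))"
    \<comment> \<open>The slack \<open>e\<close> absorbs the gap left by
      \<open>strong_duality\<close>; since its \<open>l\<close> is positive,
      \<open>dual_objective\<close> there is \<open>dual_expr\<close>.\<close>
    proof (rule ereal_le_epsilon2)
      fix e :: real
      assume "e > 0"
      then obtain l T where T: "l > 0" "set_pmf T \<subseteq> set_pmf P"
        "cross_entropy T P - shannon_entropy T \<le> E0"
        "cross_entropy T P - E0 \<le> dual_expr P E0 l + e"
        using strong_duality[OF assms] by blast
      then have "cross_entropy Q P \<le> cross_entropy T P"
        using Q(3) by (simp add: kl_div_le_iff)
      then have "Rw_star P E0 \<le> ereal (dual_objective P E0 l) + ereal e"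
        using T by (simp add: Q(2) dual_objective_def)
      also have "\<dots> \<le> (SUP l\<in>{0..}. ereal (dual_objective P E0 l)) + ereal e"
        using T(1) by (intro add_right_mono SUP_upper) auto
      finally show "Rw_star P E0 \<le> (SUP l\<in>{0..}. ereal (dual_objective P E0 l)) + ereal e" .
    qed
    show "(SUP l\<in>{0..}. ereal (dual_objective P E0 l)) \<le> Rw_star P E0"
      using Q(1) by (intro SUP_least) (simp add: Q(2) dual_objective_le kl_div_le_iff)
  qed
qed

text \<open>The first two conjuncts certify that the infima defining \<open>E_FA\<close> and
  \<open>Rw_star\<close> are attained, hence are minima.\<close>

theorem lemma1:
  fixes P :: "'a::finite pmf" and E0 Rs Rw :: real
  assumes "E0 > 0" and "Rs \<ge> 0" and "Rw \<ge> 0"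
  shows "(\<exists>Q. fa_objective P Rw Rs Q = E_FA P Rw Rs)
    \<and> (\<exists>Q. kl_div Q P \<le> ereal E0 \<and> expected_log_inv Q P - ereal E0 = Rw_star P E0)
    \<and> (E_FA P Rw Rs \<ge> ereal E0 \<longleftrightarrow> Rs \<ge> E0 \<and> ereal Rw \<le> Rw_star P E0)
    \<and> Rw_star P E0 = (SUP l\<in>{0..}. ereal (dual_objective P E0 l))"
proof (intro conjI)
  obtain Q where "kl_div Q P \<le> ereal E0" "Rw_star P E0 = ereal (cross_entropy Q P - E0)"
    using exists_Rw_star_minimizer[OF assms(1)] by blast
  then show "\<exists>Q. kl_div Q P \<le> ereal E0 \<and> expected_log_inv Q P - ereal E0 = Rw_star P E0"
    by (intro exI[of _ Q]) (simp add: kl_div_le_iff expected_log_inv_eq_cross_entropy)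
qed (use assms in \<open>simp_all add: exists_E_FA_minimizer E_FA_ge_iff Rw_star_eq_SUP_dual_objective\<close>)

end
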